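(* Let $G$ be a finite abelian group of order $n \geq 2$ and let $h$ be a positive integer. Then $$\widehat{\chi}(G,h)=\chi(G,h)=v(n,h)+1.$$
   Context: Groups are written additively. For a nonempty subset $A$ of $G$ and a positive integer $h$, $hA$ denotes the $h$-fold sumset of $A$, i.e. the set of all sums $a_1+\cdots+a_h$ of $h$ not-necessarily-distinct elements of $A$. $\langle A\rangle$ denotes the subgroup of $G$ generated by $A$; $A$ is a generating set of $G$ if $\langle A\rangle=G$. Define $$\chi(G,h)=\min\{m : \text{for every } A\subseteq G \text{ with } |A|\ge m,\ hA=G\},$$ $$\widehat{\chi}(G,h)=\min\{m : \text{for every } A\subseteq G \text{ with } \langle A\rangle=G \text{ and } |A|\ge m,\ hA=G\}.$$ Let $D(n)$ be the set of positive divisors of $n$. For $d\in D(n)$ set $$f_d(n,h)=\left(\left\lfloor \frac{d-2}{h}\right\rfloor+1\right)\cdot\frac{n}{d},$$ and let $v(n,h)=\max\{f_d(n,h) : d\in D(n)\}$. *)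

theory Defs
  imports "HOL-Algebra.Algebra"
begin

text \<open>Abelian groups are HOL-Algebra's commutative groups, so the group operation is written
  multiplicatively: sums become finite products, and the subgroup generated by \<open>A\<close> is
  \<open>generate G A\<close>.\<close>

definition sumset :: "('a, 'b) monoid_scheme \<Rightarrow> nat \<Rightarrow> 'a set \<Rightarrow> 'a set" where
  "sumset G h A = {finprod G a {1..h} | a. a \<in> {1..h} \<rightarrow> A}"

text \<open>For finite \<open>G\<close> both minima are over nonempty sets, since \<open>card (carrier G) + 1\<close>
  satisfies the condition vacuously. For \<open>h \<ge> 1\<close> the empty set has empty \<open>h\<close>-fold sumset.\<close>

definition chi :: "('a, 'b) monoid_scheme \<Rightarrow> nat \<Rightarrow> nat" where
  "chi G h = (LEAST m. \<forall>A. A \<subseteq> carrier G \<and> m \<le> card A \<longrightarrow> sumset G h A = carrier G)"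

definition chi_hat :: "('a, 'b) monoid_scheme \<Rightarrow> nat \<Rightarrow> nat" where
  "chi_hat G h = (LEAST m. \<forall>A. A \<subseteq> carrier G \<and> generate G A = carrier G \<and> m \<le> card A
      \<longrightarrow> sumset G h A = carrier G)"

text \<open>Integer \<open>div\<close> rounds towards minus infinity and so is the floor of the quotient; in
  particular the term for \<open>d = 1\<close> is \<open>0\<close>. Natural-number subtraction would give a different
  value there.\<close>

definition f :: "nat \<Rightarrow> nat \<Rightarrow> nat \<Rightarrow> int" where
  "f d n h = ((int d - 2) div int h + 1) * int (n div d)"

definition v :: "nat \<Rightarrow> nat \<Rightarrow> int" where
  "v n h = Max {f d n h | d. 0 < d \<and> d dvd n}"

end

theory Submission
  imports Defs
begin

text \<open>Upper bound: for a proper nonempty \<open>A\<close> there is a subgroup \<open>H\<close> minimising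
  \<open>|X A| - |X|\<close> over all nonempty \<open>X\<close> with \<open>X A \<noteq> G\<close>, so products of \<open>H\<close> with powers of \<open>A\<close> grow by
  at least \<open>|H A| - |H|\<close> at every step before they fill \<open>G\<close>. If \<open>H A\<^sup>h \<noteq> G\<close>, the bound for
  \<open>d = [G : H]\<close> follows by counting. Otherwise an element missed by \<open>A\<^sup>h\<close> can be written modulo \<open>H\<close>
  as a product of \<open>h\<close> elements of \<open>A\<close> only if all of them lie in one sparse coset \<open>H c\<close>; counting
  again leaves only \<open>d = 1 + h (|H A|/|H| - 1)\<close>, where the bound for the slice of \<open>A\<close> in \<open>H c\<close>,
  obtained by induction, lifts from \<open>H\<close> to \<open>G\<close>.

  Lower bound: a lexicographic initial segment along a chain of maximal subgroups attains \<open>f\<close>. If it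
  does not generate \<open>G\<close>, it is at most as large as a nontrivial coset of a maximal subgroup, which
  generates \<open>G\<close> and whose \<open>h\<close>-th power is contained in a single coset.\<close>

subsection \<open>Product sets and atoms\<close>

text \<open>Unlike \<open>finprod\<close>, this recursion never refers to the carrier, so its value
  is unchanged on passing to a subgroup. Both inductions over subgroups rely on this.\<close>

primrec kfold :: "('a, 'b) monoid_scheme \<Rightarrow> nat \<Rightarrow> 'a set \<Rightarrow> 'a set" where
  "kfold G 0 A = {\<one>\<^bsub>G\<^esub>}"
| "kfold G (Suc h) A = A <#>\<^bsub>G\<^esub> kfold G h A"

lemma kfold_consistent [simp]: "kfold (G\<lparr>carrier := H\<rparr>) h A = kfold G h A"
  by (induction h) simp_all

lemma set_multI: "a \<in> A \<Longrightarrow> b \<in> B \<Longrightarrow> a \<otimes>\<^bsub>G\<^esub> b \<in> A <#>\<^bsub>G\<^esub> B"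
  by (auto simp: set_mult_def)

lemma set_multE:
  assumes "x \<in> A <#>\<^bsub>G\<^esub> B"
  obtains a b where "a \<in> A" "b \<in> B" "x = a \<otimes>\<^bsub>G\<^esub> b"
  using assms by (auto simp: set_mult_def)

context comm_group
begin

lemma set_mult_comm:
  assumes "A \<subseteq> carrier G" "B \<subseteq> carrier G"
  shows "A <#> B = B <#> A"
  using assms by (auto simp: set_mult_def) (metis m_comm subsetD)+

lemma kfold_closed: "A \<subseteq> carrier G \<Longrightarrow> kfold G h A \<subseteq> carrier G"
  by (induction h) (simp_all add: set_mult_closed)

lemma kfold_mono: "A \<subseteq> B \<Longrightarrow> kfold G h A \<subseteq> kfold G h B"
  by (induction h) (simp_all add: mono_set_mult)

lemma set_mult_one_right: "A \<subseteq> carrier G \<Longrightarrow> A <#> {\<one>} = A"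
  by (force simp: set_mult_def)

lemma sumset_eq_kfold:
  assumes A: "A \<subseteq> carrier G"
  shows "sumset G h A = kfold G h A"
proof (induction h)
  case 0
  show ?case by (auto simp: sumset_def)
next
  case (Suc h)
  have ins: "{1..Suc h} = insert (Suc h) {1..h}" by auto
  have fp: "finprod G a {1..Suc h} = a (Suc h) \<otimes> finprod G a {1..h}"
    if "a \<in> {1..Suc h} \<rightarrow> A" for a
    unfolding ins using that A by (subst finprod_insert) (auto simp: Pi_iff)
  show ?case
  proof (intro equalityI subsetI)
    fix x assume "x \<in> sumset G (Suc h) A"
    then obtain a where a: "a \<in> {1..Suc h} \<rightarrow> A" "x = finprod G a {1..Suc h}"
      by (auto simp: sumset_def)
    have "finprod G a {1..h} \<in> sumset G h A" using a(1) unfolding sumset_def by (fastforce simp: Pi_iff)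
    then show "x \<in> kfold G (Suc h) A" using a fp[OF a(1)] Suc.IH by (auto intro!: set_multI)
  next
    fix x assume "x \<in> kfold G (Suc h) A"
    then obtain y s where x: "y \<in> A" "s \<in> sumset G h A" "x = y \<otimes> s"
      using Suc.IH by (auto elim: set_multE)
    then obtain a where a: "a \<in> {1..h} \<rightarrow> A" "s = finprod G a {1..h}"
      by (auto simp: sumset_def)
    let ?b = "a(Suc h := y)"
    have b: "?b \<in> {1..Suc h} \<rightarrow> A" using a x by (auto simp: Pi_iff)
    have "finprod G ?b {1..h} = finprod G a {1..h}"
      using a(1) A by (intro finprod_cong') (auto simp: Pi_iff)
    then have "x = finprod G ?b {1..Suc h}" using fp[OF b] x a by simp
    then show "x \<in> sumset G (Suc h) A" using b by (auto simp: sumset_def)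
  qed
qed

lemma card_translate:
  assumes "a \<in> carrier G" "S \<subseteq> carrier G"
  shows "card ({a} <#> S) = card S"
proof -
  have "{a} <#> S = (\<lambda>x. a \<otimes> x) ` S" by (auto simp: set_mult_def)
  moreover have "inj_on (\<lambda>x. a \<otimes> x) S" using assms by (intro inj_onI) (metis l_cancel subsetD)
  ultimately show ?thesis by (simp add: card_image)
qed

lemma translate_inv:
  assumes "a \<in> carrier G" "S \<subseteq> carrier G"
  shows "{a} <#> ({inv a} <#> S) = S"
proof -
  have "{a} <#> ({inv a} <#> S) = ({a} <#> {inv a}) <#> S"
    using assms by (simp add: set_mult_assoc)
  also have "\<dots> = S" using assms by (force simp: set_mult_def)
  finally show ?thesis .
qed

lemma translate_eq_carrier:
  assumes "a \<in> carrier G" "S \<subseteq> carrier G" "{a} <#> S = carrier G"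
  shows "S = carrier G"
proof -
  have "S = {inv a} <#> ({a} <#> S)" using translate_inv[of "inv a" S] assms(1,2) by simp
  also have "\<dots> = {inv a} <#> carrier G" using assms(3) by simp
  also have "\<dots> = carrier G"
  proof
    show "{inv a} <#> carrier G \<subseteq> carrier G" using assms by (intro set_mult_closed) auto
    show "carrier G \<subseteq> {inv a} <#> carrier G"
      using translate_inv[of "inv a" "carrier G"] assms(1)
      by (metis inv_closed inv_inv mono_set_mult order_refl set_mult_closed empty_subsetI insert_subset)
  qed
  finally show ?thesis .
qed

lemma carrier_set_mult:
  assumes "A \<subseteq> carrier G" "A \<noteq> {}"
  shows "carrier G <#> A = carrier G"
proof
  show "carrier G <#> A \<subseteq> carrier G" using assms by (simp add: set_mult_closed)
  obtain a where a: "a \<in> A" using assms by auto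
  then have [simp]: "a \<in> carrier G" using assms by auto
  show "carrier G \<subseteq> carrier G <#> A"
  proof
    fix x assume [simp]: "x \<in> carrier G"
    have "x = (x \<otimes> inv a) \<otimes> a" by (simp add: m_assoc)
    then show "x \<in> carrier G <#> A" using a by (metis \<open>x \<in> carrier G\<close> \<open>a \<in> carrier G\<close> inv_closed m_closed set_multI)
  qed
qed

end

section \<open>Atoms of a set in a finite abelian group\<close>

locale fin_comm_group = comm_group +
  assumes fin: "finite (carrier G)"
begin

lemma fin_sub: "A \<subseteq> carrier G \<Longrightarrow> finite A"
  using fin finite_subset by blast

lemma card_le_set_mult:
  assumes "A \<subseteq> carrier G" "A \<noteq> {}" "S \<subseteq> carrier G"
  shows "card S \<le> card (S <#> A)"
proof -
  obtain a where a: "a \<in> A" using assms by auto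
  then have "a \<in> carrier G" using assms by auto
  then have "card S = card (S <#> {a})"
    using card_translate[of a S] set_mult_comm[of S "{a}"] assms by auto
  also have "\<dots> \<le> card (S <#> A)"
    using a assms by (intro card_mono fin_sub set_mult_closed mono_set_mult) auto
  finally show ?thesis .
qed

text \<open>Among the sets minimising \<open>card (S <#> A) - card S\<close>, those of least size are translates
  of a single subgroup (Mann, Hamidoune): two of them that meet are equal. Submodularity gives this
  unless their union already covers the group, which is excluded by comparing \<open>M\<close> with the inverse
  of the complement of \<open>M <#> A\<close>.\<close>

proposition atom_subgroup:
  assumes A: "A \<subseteq> carrier G" "A \<noteq> {}" "A \<noteq> carrier G"
  obtains H where "subgroup H G" "H <#> A \<noteq> carrier G"
    "\<And>S. S \<subseteq> carrier G \<Longrightarrow> S \<noteq> {} \<Longrightarrow> S <#> A \<noteq> carrier G \<Longrightarrow>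
      card S + card (H <#> A) \<le> card (S <#> A) + card H"
proof -
  define F where "F S \<longleftrightarrow> S \<subseteq> carrier G \<and> S \<noteq> {} \<and> S <#> A \<noteq> carrier G" for S
  \<comment> \<open>No truncation occurs in this difference: multiplying by the nonempty set
    \<open>A\<close> cannot shrink a set, as recorded in \<open>cN\<close>.\<close>
  define N where "N S = card (S <#> A) - card S" for S
  have F1: "F {\<one>}" using A by (auto simp: F_def set_mult_def) force+
  obtain M0 where M0: "F M0" "\<And>S. F S \<Longrightarrow> N M0 \<le> N S"
    using ex_has_least_nat[of F _ N] F1 by blast
  obtain M where M: "F M" "N M = N M0"
      and Mleast: "\<And>S. F S \<Longrightarrow> N S = N M0 \<Longrightarrow> card M \<le> card S"
    using ex_has_least_nat[of "\<lambda>S. F S \<and> N S = N M0" M0 card] M0 by blast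
  have Nmin: "N M \<le> N S" if "F S" for S using M0 that M by simp
  have atom: "card M \<le> card S" if "F S" "N S \<le> N M" for S
    using Mleast that Nmin[of S] M(2) by auto
  have sub: "S \<subseteq> carrier G" if "F S" for S using that F_def by auto
  have cl: "S <#> A \<subseteq> carrier G" if "S \<subseteq> carrier G" for S
    using that A by (simp add: set_mult_closed)
  have cN: "card (S <#> A) = card S + N S" if "S \<subseteq> carrier G" for S
    using card_le_set_mult[OF A(1,2) that] by (simp add: N_def)
  have N1: "N M \<le> N S" if "S \<subseteq> carrier G" "S \<noteq> {}" "S <#> A \<noteq> carrier G" for S
    using Nmin that by (simp add: F_def)
  let ?n = "card (carrier G)"
  \<comment> \<open>With \<open>Y\<close> the set of inverses of the complement of
    \<open>M <#> A\<close>, the product \<open>Y <#> A\<close> avoids the inverses of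
    \<open>M\<close>. Hence \<open>N Y \<le> N M\<close>, so \<open>Y\<close> is also a minimiser
    and is at least as large as \<open>M\<close>; the size of \<open>Y\<close> then gives the
    bound.\<close>
  have dual: "2 * card M + N M \<le> ?n"
  proof -
    define Y where "Y = m_inv G ` (carrier G - (M <#> A))"
    have Ysub: "Y \<subseteq> carrier G" by (auto simp: Y_def)
    have inj: "inj_on (m_inv G) S" if "S \<subseteq> carrier G" for S
      using that by (intro inj_onI) (metis inv_inv subsetD)
    have cY: "card Y = ?n - card (M <#> A)"
      unfolding Y_def using cl[OF sub[OF M(1)]]
      by (subst card_image) (auto intro!: inj card_Diff_subset fin_sub)
    have YA: "Y <#> A \<subseteq> carrier G - m_inv G ` M"
    proof
      fix w assume "w \<in> Y <#> A"
      then obtain z a where w: "z \<in> carrier G" "z \<notin> M <#> A" "a \<in> A" "w = inv z \<otimes> a"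
        by (auto simp: Y_def elim!: set_multE)
      have ac: "a \<in> carrier G" using w A by auto
      have "w \<notin> m_inv G ` M"
      proof
        assume "w \<in> m_inv G ` M"
        then obtain m where m: "m \<in> M" "w = inv m" by auto
        then have mc: "m \<in> carrier G" using sub[OF M(1)] by auto
        have "z = m \<otimes> a"
          using w m mc ac by (metis inv_inv inv_mult inv_solve_left' m_comm inv_closed m_closed)
        then show False using w m by (auto intro!: set_multI)
      qed
      then show "w \<in> carrier G - m_inv G ` M" using w ac by auto
    qed
    have cM: "card (m_inv G ` M) = card M" using inj sub[OF M(1)] by (simp add: card_image)
    have "m_inv G ` M \<inter> carrier G \<noteq> {}" using M(1) by (auto simp: F_def)
    then have "Y <#> A \<noteq> carrier G" using YA by blast
    moreover have "Y \<noteq> {}" using M(1) cl[OF sub[OF M(1)]] by (auto simp: F_def Y_def)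
    ultimately have "F Y" using Ysub by (simp add: F_def)
    have "card (Y <#> A) \<le> card (carrier G - m_inv G ` M)"
      using YA by (intro card_mono) (auto simp: fin)
    also have "\<dots> = ?n - card M"
      using sub[OF M(1)] cM by (subst card_Diff_subset) (auto intro!: fin_sub)
    finally have cYA: "card (Y <#> A) \<le> ?n - card M" .
    have le: "card (M <#> A) \<le> ?n" by (rule card_mono[OF fin cl[OF sub[OF M(1)]]])
    have "N Y \<le> N M"
      using cYA cY cN[OF Ysub] cN[OF sub[OF M(1)]] le by linarith
    then have "card M \<le> card Y" using atom \<open>F Y\<close> by blast
    then show ?thesis using cY cN[OF sub[OF M(1)]] le by linarith
  qed
  have meet: "M = M'" if M': "F M'" "N M' = N M" "card M' = card M" and ne: "M \<inter> M' \<noteq> {}" for M'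
  proof -
    let ?I = "M \<inter> M'" and ?U = "M \<union> M'"
    have Is: "?I \<subseteq> carrier G" and Us: "?U \<subseteq> carrier G" using sub M(1) M'(1) by auto
    have finM: "finite M" "finite M'" using fin_sub sub M(1) M'(1) by auto
    have U: "?U <#> A = (M <#> A) \<union> (M' <#> A)" by (auto simp: set_mult_def)
    have I: "?I <#> A \<subseteq> (M <#> A) \<inter> (M' <#> A)" by (auto simp: set_mult_def)
    have f: "finite (M <#> A)" "finite (M' <#> A)" using fin_sub cl sub M(1) M'(1) by auto
    have "card (?I <#> A) \<le> card ((M <#> A) \<inter> (M' <#> A))" using I f by (intro card_mono) auto
    then have c1: "card (?I <#> A) + card (?U <#> A) \<le> card (M <#> A) + card (M' <#> A)"
      using card_Un_Int[OF f] U by simp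
    have c2: "card ?I + card ?U = card M + card M'" using card_Un_Int[OF finM] by simp
    have "?I <#> A \<noteq> carrier G"
      using I M(1) cl[OF sub[OF M(1)]] unfolding F_def by blast
    then have FI: "F ?I" using Is ne by (simp add: F_def)
    have cI: "card ?I > 0" using ne finM by (simp add: card_gt_0_iff)
    note cNs = cN[OF Is] cN[OF Us] cN[OF sub[OF M(1)]] cN[OF sub[OF M'(1)]]
    \<comment> \<open>If the union covered the group, \<open>c1\<close>, \<open>c2\<close> and
      \<open>N M \<le> N ?I\<close> would give \<open>card ?I + ?n \<le> 2 * card M + N M\<close>,
      against \<open>dual\<close>, because the intersection is nonempty.\<close>
    have "?U <#> A \<noteq> carrier G"
    proof
      assume "?U <#> A = carrier G"
      then show False using c1 c2 cNs cI dual M' Nmin[OF FI] by auto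
    qed
    \<comment> \<open>Now minimality applies to the union, and submodularity makes the intersection
      a minimiser as well. It cannot be smaller than \<open>M\<close>, so it equals both
      sets.\<close>
    then have "N M \<le> N ?U" using N1[OF Us] ne by blast
    then have "N ?I \<le> N M" using c1 c2 cNs M' by linarith
    then have "card M \<le> card ?I" using atom FI by blast
    then have "?I = M" "?I = M'" using finM M'(3) by (metis card_seteq inf_le1, metis card_seteq inf_le2)
    then show ?thesis by blast
  qed
  obtain m where m: "m \<in> M" using M(1) F_def by auto
  then have mc: "m \<in> carrier G" using sub[OF M(1)] by auto
  have Ms: "M \<subseteq> carrier G" using sub M by simp
  have tr: "({a} <#> M) \<subseteq> carrier G" "F ({a} <#> M)" "N ({a} <#> M) = N M" "card ({a} <#> M) = card M"
    if "a \<in> carrier G" for a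
  proof -
    show s: "({a} <#> M) \<subseteq> carrier G" using that Ms by (simp add: set_mult_closed)
    have e: "({a} <#> M) <#> A = {a} <#> (M <#> A)" using that Ms A by (simp add: set_mult_assoc)
    show c: "card ({a} <#> M) = card M" using that Ms by (rule card_translate)
    show "N ({a} <#> M) = N M" unfolding N_def c e using card_translate[OF that cl[OF Ms]] by simp
    show "F ({a} <#> M)"
      using translate_eq_carrier[OF that cl[OF Ms]] M(1) s m unfolding F_def e
      by (auto simp: set_mult_def)
  qed
  define H where "H = {inv m} <#> M"
  have H1: "\<one> \<in> H" using m mc by (auto simp: H_def set_mult_def intro!: bexI[of _ m])
  have Hs: "H \<subseteq> carrier G" using tr(1)[of "inv m"] mc by (simp add: H_def)
  \<comment> \<open>Since \<open>{inv x} <#> H\<close> contains the unit,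
    \<open>{inv x} <#> M\<close> contains \<open>m\<close>. So it meets \<open>M\<close>, and
    \<open>meet\<close> forces the two translates to agree.\<close>
  have Hx: "{inv x} <#> H = H" if x: "x \<in> H" for x
  proof -
    have xc: "x \<in> carrier G" using x Hs by auto
    have "{m} <#> ({inv x} <#> H) = ({m} <#> {inv x} <#> {inv m}) <#> M"
      using Ms mc xc by (simp add: H_def set_mult_assoc set_mult_closed)
    also have "{m} <#> {inv x} <#> {inv m} = {inv x}"
      using mc xc by (auto simp: set_mult_def m_ac) (metis inv_closed l_inv m_comm m_lcomm r_one)+
    finally have e: "{m} <#> ({inv x} <#> H) = {inv x} <#> M" .
    have "\<one> \<in> {inv x} <#> H" using x xc by (auto simp: set_mult_def intro!: bexI[of _ x])
    then have "m \<otimes> \<one> \<in> {m} <#> ({inv x} <#> H)" by (intro set_multI) auto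
    then have "m \<in> {m} <#> ({inv x} <#> H)" using mc by simp
    then have "M \<inter> ({inv x} <#> M) \<noteq> {}" using e m by auto
    then have "M = {inv x} <#> M" using meet[OF tr(2-4)[of "inv x"]] xc by simp
    then have "H = {inv m} <#> ({inv x} <#> M)" by (simp add: H_def)
    also have "\<dots> = ({inv m} <#> {inv x}) <#> M" using Ms mc xc by (simp add: set_mult_assoc)
    also have "{inv m} <#> {inv x} = {inv x} <#> {inv m}" using mc xc by (intro set_mult_comm) auto
    also have "\<dots> <#> M = {inv x} <#> H" unfolding H_def using Ms mc xc by (simp add: set_mult_assoc)
    finally show ?thesis by simp
  qed
  have Hdiv: "inv x \<otimes> y \<in> H" if "x \<in> H" "y \<in> H" for x y
    using Hx[OF that(1)] that by (auto simp: set_mult_def)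
  have Hinv: "inv x \<in> H" if "x \<in> H" for x using Hdiv[OF that H1] that Hs by auto
  have "subgroup H G"
  proof (rule subgroupI)
    show "H \<subseteq> carrier G" by fact
    show "H \<noteq> {}" using H1 by auto
    show "inv x \<in> H" if "x \<in> H" for x using Hinv that .
    show "x \<otimes> y \<in> H" if "x \<in> H" "y \<in> H" for x y
      using Hdiv[OF Hinv[OF that(1)] that(2)] that Hs by auto
  qed
  moreover have FH: "F H" and NH: "N H = N M" using tr[of "inv m"] mc by (simp_all add: H_def)
  moreover have "card S + card (H <#> A) \<le> card (S <#> A) + card H"
    if "S \<subseteq> carrier G" "S \<noteq> {}" "S <#> A \<noteq> carrier G" for S
    using N1[OF that] cN[OF that(1)] cN[OF Hs] NH by simp
  ultimately show thesis using that[of H] FH by (auto simp: F_def)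
qed

end

subsection \<open>The upper bound\<close>

lemma f_ge:
  assumes "h \<ge> 1" "h * k + 2 \<le> d" "q > 0"
  shows "int (Suc k * q) \<le> f d (d * q) h"
proof -
  have "int k = (int (h * k)) div int h" using assms by simp
  also have "\<dots> \<le> (int d - 2) div int h"
    using assms by (intro zdiv_mono1) (simp_all flip: of_nat_mult)
  finally have "int (Suc k) \<le> (int d - 2) div int h + 1" by simp
  then have "int (Suc k) * int q \<le> ((int d - 2) div int h + 1) * int q"
    by (intro mult_right_mono) auto
  moreover have "d * q div d = q" using assms by simp
  ultimately show ?thesis by (simp only: f_def of_nat_mult)
qed

text \<open>The numerator \<open>(1 + h * k) * e - 2\<close> exceeds \<open>e - 2\<close> by the
  multiple \<open>h * k * e\<close> of \<open>h\<close>, which leaves the floor as an integer. This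
  identity lifts a bound from a subgroup of order \<open>q\<close> and index
  \<open>1 + h * k\<close> to the group; the lower bound uses it in the same way.\<close>

lemma f_mult:
  assumes "h \<ge> 1" "e dvd q" "q > 0"
  shows "f ((1 + h * k) * e) ((1 + h * k) * q) h = int (k * q) + f e q h"
proof -
  obtain r where r: "q = e * r" using assms by auto
  have e: "e > 0" using assms r by auto
  have "int ((1 + h * k) * e) - 2 = int h * (int k * int e) + (int e - 2)"
    by (simp add: algebra_simps)
  then have "(int ((1 + h * k) * e) - 2) div int h = int k * int e + (int e - 2) div int h"
    using assms by (simp only: mult.assoc div_mult_self4)
  moreover have "(1 + h * k) * q div ((1 + h * k) * e) = r"
    using e by (subst div_mult_mult1) (simp_all add: r)
  moreover have "q div e = r" using e by (simp add: r)
  ultimately show ?thesis by (simp add: f_def r algebra_simps)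
qed

lemma f_one: "h \<ge> 1 \<Longrightarrow> f 1 n h = 0"
  by (simp add: f_def div_eq_minus1)

context comm_group
begin

lemma kfold_nonempty: "A \<noteq> {} \<Longrightarrow> kfold G h A \<noteq> {}"
  by (induction h) (auto simp: set_mult_def)

lemma kfold_add:
  "A \<subseteq> carrier G \<Longrightarrow> kfold G (i + j) A = kfold G i A <#> kfold G j A"
proof (induction i)
  case 0
  then show ?case using kfold_closed[of A j] by (force simp: set_mult_def)
next
  case (Suc i)
  then show ?case by (simp add: set_mult_assoc kfold_closed)
qed

lemma kfold_translate:
  assumes "a \<in> carrier G" "A \<subseteq> carrier G"
  shows "kfold G h ({a} <#> A) = {a [^] h} <#> kfold G h A"
proof (induction h)
  case 0
  then show ?case by (auto simp: set_mult_def)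
next
  case (Suc h)
  have "kfold G (Suc h) ({a} <#> A) = {a} <#> (A <#> ({a [^] h} <#> kfold G h A))"
    using assms by (simp add: Suc set_mult_assoc set_mult_closed kfold_closed)
  also have "A <#> ({a [^] h} <#> kfold G h A) = ({a [^] h} <#> A) <#> kfold G h A"
    using assms set_mult_comm[of A "{a [^] h}"]
    by (subst set_mult_assoc[symmetric]) (auto simp: kfold_closed)
  also have "{a} <#> ({a [^] h} <#> A <#> kfold G h A) = ({a} <#> {a [^] h}) <#> kfold G (Suc h) A"
    using assms by (simp add: set_mult_assoc set_mult_closed kfold_closed)
  also have "{a} <#> {a [^] h} = {a [^] Suc h}"
    using assms by (auto simp: set_mult_def m_comm)
  finally show ?case .
qed

lemma coset_mem_eq:
  assumes "subgroup H G" "a \<in> carrier G" "b \<in> H #> a"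
  shows "H #> b = H #> a"
  using repr_independence[of b H a] assms by auto

end

section \<open>Cosets of a subgroup and growth of powers\<close>

context fin_comm_group
begin

lemma card_dvd_set_mult:
  assumes H: "subgroup H G" and B: "B \<subseteq> carrier G"
  shows "card H dvd card (H <#> B)"
proof -
  let ?C = "(\<lambda>b. H #> b) ` B"
  have Hs: "H \<subseteq> carrier G" using H by (rule subgroup.subset)
  have U: "\<Union>?C = H <#> B" by (auto simp: set_mult_def r_coset_def)
  have sub: "?C \<subseteq> rcosets H" using B by (auto simp: RCOSETS_def)
  have "card H * card ?C = card (\<Union>?C)"
  proof (rule card_partition)
    show "finite ?C" using B fin_sub by auto
    show "finite (\<Union>?C)" unfolding U using B Hs by (intro fin_sub set_mult_closed)
    show "card c = card H" if "c \<in> ?C" for c using that sub card_rcosets_equal Hs by auto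
    show "c1 \<inter> c2 = {}" if "c1 \<in> ?C" "c2 \<in> ?C" "c1 \<noteq> c2" for c1 c2
      using rcos_disjoint[OF H] that sub unfolding pairwise_def disjnt_def by blast
  qed
  then show ?thesis using U by (metis dvd_triv_left)
qed

lemma card_coset:
  assumes "subgroup H G" "a \<in> carrier G"
  shows "card (H #> a) = card H"
  using card_rcosets_equal[of "H #> a" H] rcosetsI[OF subgroup.subset] assms
  by (simp add: subgroup.subset)

lemma coset_subset_set_mult:
  assumes H: "subgroup H G" and c: "a \<in> carrier G" "b \<in> carrier G"
    and P: "P \<subseteq> H #> a" "Q \<subseteq> H #> b" and card: "card H < card P + card Q"
  shows "H #> (a \<otimes> b) \<subseteq> P <#> Q"
proof
  fix z assume z: "z \<in> H #> (a \<otimes> b)"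
  have Hs: "H \<subseteq> carrier G" using H by (rule subgroup.subset)
  obtain x where x: "x \<in> H" "z = x \<otimes> (a \<otimes> b)" using z by (auto simp: r_coset_def)
  have xc: "x \<in> carrier G" and zc: "z \<in> carrier G" using x Hs c by auto
  let ?R = "(\<lambda>y. z \<otimes> inv y) ` Q"
  have Qs: "Q \<subseteq> carrier G" using P(2) r_coset_subset_G[OF Hs c(2)] by auto
  have "inj_on (\<lambda>y. z \<otimes> inv y) Q"
    using Qs zc by (intro inj_onI) (metis inv_closed inv_inv l_cancel subsetD)
  then have cR: "card ?R = card Q" by (rule card_image)
  have R: "?R \<subseteq> H #> a"
  proof
    fix w assume "w \<in> ?R"
    then obtain y where y: "y \<in> H" "w = z \<otimes> inv (y \<otimes> b)"
      using P(2) by (auto simp: r_coset_def)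
    have yc: "y \<in> carrier G" using y Hs by auto
    have "w = x \<otimes> (a \<otimes> b) \<otimes> (inv y \<otimes> inv b)" using y x yc c by (simp add: inv_mult)
    also have "\<dots> = (x \<otimes> inv y) \<otimes> a \<otimes> (b \<otimes> inv b)"
    proof -
      have "x \<otimes> (a \<otimes> b) \<otimes> (t \<otimes> u) = (x \<otimes> t) \<otimes> a \<otimes> (b \<otimes> u)"
        if "t \<in> carrier G" "u \<in> carrier G" for t u
        using that xc c by (simp add: m_ac)
      then show ?thesis using yc c by simp
    qed
    also have "\<dots> = (x \<otimes> inv y) \<otimes> a" using yc xc c by simp
    finally show "w \<in> H #> a" using x y H
      by (auto simp: r_coset_def subgroup.m_closed subgroup.m_inv_closed)
  qed
  have f: "finite (H #> a)" using fin_sub r_coset_subset_G[OF Hs c(1)] by simp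
  have "P \<inter> ?R \<noteq> {}"
  proof
    assume "P \<inter> ?R = {}"
    then have "card P + card ?R = card (P \<union> ?R)"
      using f P R by (intro card_Un_disjoint[symmetric]) (auto intro: finite_subset)
    also have "\<dots> \<le> card (H #> a)" using f P R by (intro card_mono) auto
    finally show False using cR card card_coset[OF H c(1)] by simp
  qed
  then obtain p y where py: "p \<in> P" "y \<in> Q" "p = z \<otimes> inv y" by auto
  then have "z = p \<otimes> y" using zc Qs by (auto simp: m_assoc)
  then show "z \<in> P <#> Q" using py set_multI[of p P y Q G] by simp
qed

text \<open>The inequality \<open>atom\<close> is applied to \<open>H <#> kfold G j A\<close> at
  each step. These sets are proper as long as the next one is, because the whole group times
  \<open>A\<close> is the whole group.\<close>

lemma card_kfold_ge:
  assumes A: "A \<subseteq> carrier G" "A \<noteq> {}" and H: "subgroup H G"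
    and atom: "\<And>S. S \<subseteq> carrier G \<Longrightarrow> S \<noteq> {} \<Longrightarrow> S <#> A \<noteq> carrier G \<Longrightarrow>
      card S + card (H <#> A) \<le> card (S <#> A) + card H"
  shows "H <#> kfold G j A \<noteq> carrier G \<Longrightarrow>
    card H + j * (card (H <#> A) - card H) \<le> card (H <#> kfold G j A)"
proof (induction j)
  case 0
  then show ?case using set_mult_one_right H by (simp add: subgroup.subset)
next
  case (Suc j)
  have Hs: "H \<subseteq> carrier G" using H by (rule subgroup.subset)
  let ?S = "H <#> kfold G j A"
  have S: "?S \<subseteq> carrier G" using A Hs by (simp add: set_mult_closed kfold_closed)
  have "H <#> kfold G (Suc j) A = ?S <#> A"
    using A Hs kfold_add[of A j 1] set_mult_one_right by (simp add: set_mult_assoc kfold_closed)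
  moreover have "?S \<noteq> {}"
    using kfold_nonempty[of A j] A(2) subgroup.one_closed[OF H] by (auto simp: set_mult_def)
  moreover have "?S \<noteq> carrier G" using Suc.prems carrier_set_mult[OF A] calculation by auto
  moreover have "card H \<le> card (H <#> A)" using card_le_set_mult A Hs by simp
  moreover have "Suc j * (card (H <#> A) - card H) =
      card (H <#> A) - card H + j * (card (H <#> A) - card H)" by simp
  ultimately show ?case using Suc.IH atom[OF S] Suc.prems by simp
qed

lemma fin_comm_group_subgroup:
  assumes "subgroup H G"
  shows "fin_comm_group (G\<lparr>carrier := H\<rparr>)"
proof -
  have "comm_group (G\<lparr>carrier := H\<rparr>)" 
    using subgroup_imp_group[OF assms] m_comm subgroup.subset[OF assms]
    by (intro group.group_comm_groupI) auto
  moreover have "finite H" using fin_sub assms subgroup.subset by blast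
  ultimately show ?thesis by (simp add: fin_comm_group_def fin_comm_group_axioms_def)
qed

end

section \<open>Induction step of the upper bound\<close>

context fin_comm_group
begin

text \<open>The hypothesis \<open>IH\<close> is invoked just once, for the atom \<open>H\<close> and
  a translate of the part of \<open>A\<close> in one coset of \<open>H\<close>.\<close>

lemma ex_f_ge_card_step:
  assumes h: "h \<ge> 1" and A: "A \<subseteq> carrier G" and hA: "kfold G h A \<noteq> carrier G"
    and IH: "\<And>H B. subgroup H G \<Longrightarrow> H \<noteq> carrier G \<Longrightarrow> B \<subseteq> H \<Longrightarrow> kfold G h B \<noteq> H \<Longrightarrow>
      \<exists>e>0. e dvd card H \<and> int (card B) \<le> f e (card H) h"
  shows "\<exists>d>0. d dvd order G \<and> int (card A) \<le> f d (order G) h"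
proof (cases "A = {}")
  case True
  then show ?thesis using f_one[OF h] by (intro exI[of _ 1]) simp
next
  case ne: False
  obtain h' where h': "h = Suc h'" using h by (cases h) auto
  have "A \<noteq> carrier G"
  proof
    assume eq: "A = carrier G"
    have "kfold G h A = carrier G"
      unfolding h' eq using carrier_set_mult[OF kfold_closed kfold_nonempty, of "carrier G" h'] by auto
    then show False using hA by simp
  qed
  then obtain H where H: "subgroup H G" and HA: "H <#> A \<noteq> carrier G"
    and atom: "\<And>S. S \<subseteq> carrier G \<Longrightarrow> S \<noteq> {} \<Longrightarrow> S <#> A \<noteq> carrier G \<Longrightarrow>
      card S + card (H <#> A) \<le> card (S <#> A) + card H"
    using atom_subgroup A ne by blast
  have Hs: "H \<subseteq> carrier G" using H by (rule subgroup.subset)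
  have H1: "\<one> \<in> H" using H by (rule subgroup.one_closed)
  define q where "q = card H"
  have q: "q > 0" using H1 Hs fin_sub by (auto simp: q_def card_gt_0_iff)
  obtain d where d: "order G = d * q" using lagrange[OF H] by (metis q_def)
  have HAs: "H <#> A \<subseteq> carrier G" using A Hs by (simp add: set_mult_closed)
  obtain k0 where k0: "card (H <#> A) = k0 * q"
    using card_dvd_set_mult[OF H A] by (metis dvd_def mult.commute q_def)
  have "q \<le> card (H <#> A)" using card_le_set_mult[OF A ne Hs] by (simp add: q_def)
  \<comment> \<open>So \<open>A\<close> meets exactly \<open>k + 1\<close> cosets of
    \<open>H\<close>, out of \<open>d\<close>.\<close>
  then obtain k where k: "card (H <#> A) = Suc k * q" using k0 q by (cases k0) auto
  have AHA: "A \<subseteq> H <#> A" using H1 A by (force simp: set_mult_def)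
  have cA: "card A \<le> Suc k * q" using k AHA fin_sub[OF HAs] by (metis card_mono)
  have growth: "q + j * (k * q) \<le> card (H <#> kfold G j A)"
    if "H <#> kfold G j A \<noteq> carrier G" for j
    using card_kfold_ge[OF A ne H atom that] k by (simp add: q_def)
  have small: ?thesis if "h * k + 2 \<le> d"
  proof -
    have "int (card A) \<le> f d (d * q) h" using f_ge[OF h that q] cA by linarith
    then show ?thesis using that d by (intro exI[of _ d]) auto
  qed
  show ?thesis
  proof (cases "H <#> kfold G h A = carrier G")
    case False
    let ?S = "H <#> kfold G h A"
    have S: "?S \<subseteq> carrier G" using A Hs by (simp add: set_mult_closed kfold_closed)
    have "card ?S < order G" unfolding order_def using False S by (intro psubset_card_mono[OF fin]) auto
    then have "(1 + h * k) * q < d * q" using growth[OF False] d by (simp add: algebra_simps)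
    then have "1 + h * k < d" by (simp only: mult_less_cancel2)
    then show ?thesis using small by simp
  next
    case HhA: True
    obtain g where g: "g \<in> carrier G" "g \<notin> kfold G h A"
      using hA kfold_closed[OF A, of h] by blast
    \<comment> \<open>The product \<open>H <#> A\<close> is proper while
      \<open>H <#> kfold G h A\<close> is everything, so \<open>h\<close> is at least 2 and any
      product of \<open>h\<close> elements of \<open>A\<close> has two factors to compare.\<close>
    have "h' \<noteq> 0"
    proof
      assume "h' = 0"
      then show False using HhA HA set_mult_one_right[OF A] by (simp add: h')
    qed
    then obtain m where m: "h' = Suc m" by (cases h') auto
    define cell where "cell a = A \<inter> (H #> a)" for a
    have cells: "cell a \<subseteq> H #> a" "cell a \<subseteq> A" for a by (auto simp: cell_def)
    \<comment> \<open>Taking the set consisting of the unit in \<open>atom\<close> shows that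
      \<open>A\<close> lacks fewer than \<open>q\<close> elements of \<open>H <#> A\<close>.\<close>
    have holes: "card (H <#> A) < card A + q"
    proof -
      have "{\<one>} <#> A = A" using A by (force simp: set_mult_def)
      then show ?thesis using atom[of "{\<one>}"] \<open>A \<noteq> carrier G\<close> by (simp add: q_def)
    qed
    \<comment> \<open>The gaps of \<open>A\<close> in two different cosets that it meets total less
      than \<open>q\<close>, out of \<open>2 * q\<close> places.\<close>
    have diff: "q < card (cell a) + card (cell b)"
      if "a \<in> A" "b \<in> A" "H #> a \<noteq> H #> b" for a b
    proof -
      have c: "a \<in> carrier G" "b \<in> carrier G" using that A by auto
      have dj: "(H #> a) \<inter> (H #> b) = {}"
        using rcos_disjoint[OF H] c that(3) unfolding pairwise_def disjnt_def RCOSETS_def by blast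
      let ?D = "((H #> a) - A) \<union> ((H #> b) - A)"
      have fc: "finite (H #> a)" "finite (H #> b)"
        using fin_sub r_coset_subset_G[OF Hs] c by auto
      have "?D \<subseteq> (H <#> A) - A"
        using that by (auto simp: r_coset_def set_mult_def)
      then have "card ?D \<le> card ((H <#> A) - A)"
        using fin_sub[OF HAs] by (intro card_mono) auto
      also have "\<dots> = card (H <#> A) - card A" using AHA fin_sub[OF A] by (simp add: card_Diff_subset)
      also have "\<dots> < q" using holes q by linarith
      finally have "card ?D < q" .
      moreover have "card ?D = card ((H #> a) - A) + card ((H #> b) - A)"
        using dj fc by (intro card_Un_disjoint) auto
      moreover have "card ((H #> x) - A) + card (cell x) = q" if "x \<in> carrier G" for x
      proof -
        have "finite (H #> x)" using that Hs by (intro fin_sub r_coset_subset_G)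
        then have "card ((H #> x) - A) + card (cell x) = card (H #> x)"
          unfolding cell_def
          by (subst card_Un_disjoint[symmetric]) (auto intro!: arg_cong[where f = card])
        then show ?thesis using card_coset[OF H that] by (simp add: q_def)
      qed
      ultimately show ?thesis using c by (smt (verit) add.commute add_less_cancel_left add_mono_thms_linordered_field(5) nat_add_left_cancel_less)
    qed
    \<comment> \<open>If the cells of \<open>a\<close> and \<open>b\<close> together had more than
      \<open>q\<close> elements, their product would fill a whole coset and absorb \<open>x\<close>.
      Then \<open>g\<close> would be a product of \<open>h\<close> elements of \<open>A\<close>. So
      the cells are small, and by \<open>diff\<close> they lie in one coset.\<close>
    have rep: "H #> a = H #> b \<and> 2 * card (cell a) \<le> q"
      if r: "x \<in> H" "a \<in> A" "b \<in> A" "s \<in> kfold G m A" "g = x \<otimes> (a \<otimes> (b \<otimes> s))" for x a b s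
    proof -
      have c: "x \<in> carrier G" "a \<in> carrier G" "b \<in> carrier G" "s \<in> carrier G"
        using r A Hs kfold_closed[OF A] by auto
      have le: "card (cell a) + card (cell b) \<le> q"
      proof (rule ccontr)
        assume "\<not> ?thesis"
        then have "H #> (a \<otimes> b) \<subseteq> cell a <#> cell b"
          using c by (intro coset_subset_set_mult[OF H]) (auto simp: cells q_def)
        moreover have "x \<otimes> (a \<otimes> b) \<in> H #> (a \<otimes> b)" using r by (auto simp: r_coset_def)
        ultimately have "x \<otimes> (a \<otimes> b) \<in> cell a <#> cell b" by blast
        then obtain a' b' where ab: "a' \<in> A" "b' \<in> A" "x \<otimes> (a \<otimes> b) = a' \<otimes> b'"
          using cells(2) by (blast elim!: set_multE)
        have "g = (x \<otimes> (a \<otimes> b)) \<otimes> s" using r c by (simp add: m_assoc)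
        also have "\<dots> = a' \<otimes> (b' \<otimes> s)" unfolding ab(3) using ab(1,2) c A by (simp add: m_assoc subset_iff)
        finally have "g \<in> kfold G h A" using ab r h' m by (auto intro!: set_multI)
        then show False using g by simp
      qed
      then have "H #> a = H #> b" using diff r by fastforce
      then show ?thesis using le by (simp add: cell_def)
    qed
    have "g \<in> H <#> (A <#> (A <#> kfold G m A))" using HhA g h' m by simp
    then obtain x0 c b0 s0 where c: "x0 \<in> H" "c \<in> A" "b0 \<in> A" "s0 \<in> kfold G m A"
        "g = x0 \<otimes> (c \<otimes> (b0 \<otimes> s0))" by (auto elim!: set_multE)
    have cc: "c \<in> carrier G" using c A by auto
    have cq: "2 * card (cell c) \<le> q" using rep[OF c] by simp
    \<comment> \<open>By \<open>rep\<close> every factor in such an expression of \<open>g\<close>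
      has a cell of size at most \<open>q / 2\<close>. Two different cosets cannot both have such
      cells, by \<open>diff\<close>.\<close>
    have one_coset: "a \<in> H #> c" if r: "x \<in> H" "a \<in> A" "s \<in> kfold G h' A" "g = x \<otimes> (a \<otimes> s)" for x a s
    proof (rule ccontr)
      assume "a \<notin> H #> c"
      then have "H #> a \<noteq> H #> c" using rcos_self[OF _ H, of a] r A by auto
      obtain b s' where "b \<in> A" "s' \<in> kfold G m A" "s = b \<otimes> s'"
        using r(3) m by (auto elim: set_multE)
      then have "2 * card (cell a) \<le> q" using rep r by blast
      then show False using diff[OF r(2) c(2) \<open>H #> a \<noteq> H #> c\<close>] cq by simp
    qed
    \<comment> \<open>By commutativity each factor can be moved to the front, where
      \<open>one_coset\<close> applies; so a partial product of \<open>i\<close> factors lies in the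
      coset of \<open>c [^] i\<close>.\<close>
    have all: "s \<in> H #> (c [^] i)"
      if "i \<le> h" "s \<in> kfold G i A" "t \<in> kfold G (h - i) A" "x \<in> H" "g = x \<otimes> (s \<otimes> t)" for i s t x
      using that
    proof (induction i arbitrary: s t)
      case 0
      then show ?case using rcos_self[OF one_closed H] by simp
    next
      case (Suc i)
      obtain a s' where s: "a \<in> A" "s' \<in> kfold G i A" "s = a \<otimes> s'"
        using Suc.prems by (auto elim: set_multE)
      have car: "a \<in> carrier G" "s' \<in> carrier G" "t \<in> carrier G" "x \<in> carrier G"
        using s Suc.prems A Hs kfold_closed[OF A] by auto
      have hi: "h - i = Suc (h - Suc i)" "h' = i + (h - Suc i)" using Suc.prems h' by auto
      have "a \<otimes> t \<in> kfold G (h - i) A" unfolding hi(1) using s Suc.prems by (auto intro: set_multI)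
      moreover have "g = x \<otimes> (s' \<otimes> (a \<otimes> t))" using Suc.prems s car by (simp add: m_ac)
      ultimately have IH: "s' \<in> H #> (c [^] i)" using Suc.IH[of s' "a \<otimes> t"] Suc.prems s by auto
      have "s' \<otimes> t \<in> kfold G h' A"
        unfolding hi(2) kfold_add[OF A] using s Suc.prems by (auto intro: set_multI)
      moreover have "g = x \<otimes> (a \<otimes> (s' \<otimes> t))" using Suc.prems s car by (simp add: m_ac)
      ultimately have "a \<in> H #> c" using one_coset s Suc.prems by blast
      then obtain y z where yz: "y \<in> H" "a = y \<otimes> c" "z \<in> H" "s' = z \<otimes> c [^] i"
        using IH by (auto simp: r_coset_def)
      have "y \<in> carrier G" "z \<in> carrier G" using yz Hs by auto
      then have "s = (y \<otimes> z) \<otimes> c [^] Suc i" using s yz cc by (simp add: m_ac)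
      then show ?case using yz subgroup.m_closed[OF H] by (auto simp: r_coset_def)
    qed
    have gc: "g \<in> H #> (c [^] h)"
    proof -
      let ?s = "c \<otimes> (b0 \<otimes> s0)"
      have s: "?s \<in> kfold G h A" using c h' m by (auto intro: set_multI)
      then have "?s \<in> carrier G" using kfold_closed[OF A] by blast
      then have "?s \<in> H #> (c [^] h)" using all[of h ?s \<one> x0] s c by auto
      moreover have "g \<in> H #> ?s" using c by (auto simp: r_coset_def)
      ultimately show ?thesis using coset_mem_eq[OF H, of "c [^] h" ?s] cc by auto
    qed
    define A1 where "A1 = A - (H #> c)"
    have A1: "A1 \<subseteq> carrier G" using A by (auto simp: A1_def)
    have HA1: "H <#> A1 \<subseteq> carrier G" using A1 Hs by (simp add: set_mult_closed)
    have split: "H <#> A = (H #> c) \<union> (H <#> A1)"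
    proof
      show "H <#> A \<subseteq> (H #> c) \<union> (H <#> A1)"
      proof
        fix w assume "w \<in> H <#> A"
        then obtain x a where w: "x \<in> H" "a \<in> A" "w = x \<otimes> a" by (auto elim: set_multE)
        show "w \<in> (H #> c) \<union> (H <#> A1)"
        proof (cases "a \<in> H #> c")
          case True
          have "w \<in> H #> a" using w by (auto simp: r_coset_def)
          then show ?thesis using coset_mem_eq[OF H cc True] by simp
        next
          case False
          then show ?thesis using w by (auto simp: A1_def intro: set_multI)
        qed
      qed
      show "(H #> c) \<union> (H <#> A1) \<subseteq> H <#> A"
        using c by (auto simp: A1_def r_coset_def set_mult_def)
    qed
    have disj: "(H #> c) \<inter> (H <#> A1) = {}"
    proof (rule ccontr)
      assume "\<not> ?thesis"
      then obtain x a where xa: "x \<in> H" "a \<in> A1" "x \<otimes> a \<in> H #> c" by (auto elim!: set_multE)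
      have ac: "a \<in> carrier G" using xa A1 by auto
      have "x \<otimes> a \<in> H #> a" using xa by (auto simp: r_coset_def)
      then have "H #> a = H #> c" using coset_mem_eq[OF H] xa ac cc by metis
      then show False using rcos_self[OF ac H] xa(2) by (simp add: A1_def)
    qed
    have "finite (H <#> A1)" "finite (H #> c)"
      using HA1 fin_sub r_coset_subset_G[OF Hs cc] by auto
    then have cHA1: "card (H <#> A1) = k * q"
      using split card_Un_disjoint[OF _ _ disj] k card_coset[OF H cc] by (simp add: q_def)
    \<comment> \<open>If \<open>H <#> kfold G h' A\<close> met the set \<open>?T\<close> of all
      \<open>g \<otimes> inv y\<close> with \<open>y \<in> H <#> A1\<close>, then \<open>g\<close>
      would have an expression with a factor outside \<open>H #> c\<close>. Being disjoint, the two
      sets have total size at most \<open>d * q\<close>; growth over \<open>h - 1\<close> steps and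
      the \<open>k\<close> cosets in \<open>?T\<close> account for
      \<open>(1 + h * k) * q\<close>.\<close>
    have dk: "1 + h * k \<le> d"
    proof (cases "A1 = {}")
      case True
      then have "k = 0" using cHA1 q by (simp add: set_mult_def)
      moreover have "d > 0" using d fin by (cases d) (auto simp: order_def)
      ultimately show ?thesis by simp
    next
      case False
      let ?S = "H <#> kfold G h' A" and ?T = "(\<lambda>y. g \<otimes> inv y) ` (H <#> A1)"
      have S: "?S \<subseteq> carrier G" using A Hs by (simp add: set_mult_closed kfold_closed)
      have T: "?T \<subseteq> carrier G" using HA1 g by auto
      have "inj_on (\<lambda>y. g \<otimes> inv y) (H <#> A1)"
        using HA1 g by (intro inj_onI) (metis inv_closed inv_inv l_cancel subsetD)
      then have cT: "card ?T = k * q" using cHA1 by (simp add: card_image)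
      have ST: "?S \<inter> ?T = {}"
      proof (rule ccontr)
        assume "\<not> ?thesis"
        then obtain x s x' a where w: "x \<in> H" "s \<in> kfold G h' A" "x' \<in> H" "a \<in> A1"
            "x \<otimes> s = g \<otimes> inv (x' \<otimes> a)" by (auto elim!: set_multE)
        have car: "x \<in> carrier G" "x' \<in> carrier G" "s \<in> carrier G" "a \<in> carrier G"
          using w A1 Hs kfold_closed[OF A] by auto
        have "g = (x \<otimes> s) \<otimes> (x' \<otimes> a)" using w car g by (simp add: m_assoc)
        also have "\<dots> = (x \<otimes> x') \<otimes> (a \<otimes> s)" using car by (simp add: m_ac)
        finally have "a \<in> H #> c"
          using one_coset[of "x \<otimes> x'" a s] w subgroup.m_closed[OF H] by (auto simp: A1_def)
        then show False using w by (simp add: A1_def)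
      qed
      have "?T \<noteq> {}" using False H1 by (auto simp: set_mult_def)
      then have "?S \<noteq> carrier G" using ST T by blast
      then have "q + h' * (k * q) + k * q \<le> card ?S + card ?T" using growth cT by simp
      also have "\<dots> = card (?S \<union> ?T)"
        using ST S T fin_sub by (intro card_Un_disjoint[symmetric]) auto
      also have "\<dots> \<le> d * q" using S T d by (auto simp flip: d simp: order_def intro!: card_mono fin)
      finally have "(1 + h * k) * q \<le> d * q" by (simp add: h' algebra_simps)
      then show ?thesis using q by (simp only: mult_le_cancel2)
    qed
    show ?thesis
    proof (cases "d = 1 + h * k")
      case False
      then show ?thesis using dk small by simp
    next
      case dk: True
      define B where "B = {inv c} <#> cell c"
      have cellc: "cell c \<subseteq> carrier G" using A by (auto simp: cell_def)
      have cB: "card B = card (cell c)" unfolding B_def using cc cellc by (intro card_translate) auto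
      have BH: "B \<subseteq> H"
      proof
        fix w assume "w \<in> B"
        then obtain y where y: "y \<in> H" "w = inv c \<otimes> (y \<otimes> c)"
          by (auto simp: B_def cell_def r_coset_def elim!: set_multE)
        then have "w = y" using cc Hs by (metis inv_closed l_inv m_assoc m_comm r_one subsetD m_closed)
        then show "w \<in> H" using y by simp
      qed
      \<comment> \<open>Otherwise the powers of the slice \<open>cell c\<close> alone would fill the
        coset of \<open>c [^] h\<close>, which contains \<open>g\<close>.\<close>
      have kB: "kfold G h B \<noteq> H"
      proof
        assume eq: "kfold G h B = H"
        have "{c} <#> B = cell c" unfolding B_def using cc cellc by (rule translate_inv)
        then have "kfold G h (cell c) = {c [^] h} <#> H"
          using kfold_translate[OF cc, of B h] BH Hs eq by auto
        moreover have "g \<in> {c [^] h} <#> H"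
          using gc cc Hs by (auto simp: r_coset_def set_mult_def) (metis m_comm nat_pow_closed subsetD)
        ultimately show False using kfold_mono[OF cells(2), of h c] g by auto
      qed
      have "H \<noteq> carrier G" using HA carrier_set_mult[OF A ne] by auto
      then obtain e where e: "e > 0" "e dvd q" "int (card B) \<le> f e q h"
        using IH[OF H _ BH kB] by (auto simp: q_def)
      have "card A \<le> card (H <#> A1) + card (cell c)"
      proof -
        have "A \<subseteq> (H <#> A1) \<union> cell c"
          using AHA split by (auto simp: cell_def)
        then have "card A \<le> card ((H <#> A1) \<union> cell c)"
          using HA1 cellc fin_sub by (intro card_mono) auto
        also have "\<dots> \<le> card (H <#> A1) + card (cell c)" by (rule card_Un_le)
        finally show ?thesis .
      qed
      then have "int (card A) \<le> int (k * q) + f e q h" using e cB cHA1 by linarith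
      also have "\<dots> = f (d * e) (d * q) h" using f_mult[OF h e(2) q] dk by simp
      finally have "int (card A) \<le> f (d * e) (order G) h" by (simp add: d)
      moreover have "d * e dvd order G" "d * e > 0" using e d dk by (simp_all only: mult_dvd_mono dvd_refl) simp
      ultimately show ?thesis by blast
    qed
  qed
qed

end

text \<open>Strong induction on the order with \<open>G\<close> arbitrary: a subgroup becomes a
  structure of the same type by replacing the carrier.\<close>

proposition ex_f_ge_card:
  fixes G :: "('a, 'b) monoid_scheme"
  assumes "fin_comm_group G" "h \<ge> 1" "A \<subseteq> carrier G" "kfold G h A \<noteq> carrier G"
  shows "\<exists>d>0. d dvd order G \<and> int (card A) \<le> f d (order G) h"
  using assms
proof (induction "order G" arbitrary: G A rule: less_induct)
  case less
  interpret fin_comm_group G by fact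
  show ?case
  proof (rule ex_f_ge_card_step[OF less.prems(2-4)])
    fix H B
    assume H: "subgroup H G" "H \<noteq> carrier G" and B: "B \<subseteq> H" "kfold G h B \<noteq> H"
    have "order (G\<lparr>carrier := H\<rparr>) < order G"
      using H subgroup.subset[OF H(1)] by (auto simp: order_def intro!: psubset_card_mono fin)
    then show "\<exists>e>0. e dvd card H \<and> int (card B) \<le> f e (card H) h"
      using less.hyps[of "G\<lparr>carrier := H\<rparr>" B] fin_comm_group_subgroup[OF H(1)] less.prems(2) B
      by (simp add: order_def)
  qed
qed

subsection \<open>The lower bound\<close>

text \<open>Put \<open>Q = (p - 2) div h + 1\<close>. If \<open>h\<close> does not divide
  \<open>p - 1\<close>, then \<open>p \<le> h * Q\<close>, so \<open>p * e - 2 < h * Q * e\<close>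
  and refining the divisor \<open>p\<close> to \<open>p * e\<close> gains nothing.\<close>

lemma f_mult_le:
  assumes h: "h \<ge> 1" and p: "p > 0" "\<not> h dvd p - 1" and e: "e > 0"
  shows "f (p * e) (p * (e * r)) h \<le> f p (p * (e * r)) h"
proof -
  define Q where "Q = (int p - 2) div int h + 1"
  have hpos: "int h > 0" using h by simp
  have "int p - 2 = int h * (Q - 1) + (int p - 2) mod int h" by (simp add: Q_def)
  moreover have "(int p - 2) mod int h < int h" using hpos by simp
  ultimately have lt: "int p - 2 < int h * Q" by (simp add: algebra_simps)
  have "int p - 1 \<noteq> int h * Q"
  proof
    assume "int p - 1 = int h * Q"
    then have "int h dvd int (p - 1)" using p by (simp add: of_nat_diff)
    then show False using p by (simp only: int_dvd_int_iff)
  qed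
  then have "int p \<le> int h * Q" using lt by simp
  then have le: "int p * int e \<le> int h * Q * int e" by (intro mult_right_mono) auto
  have "(int p * int e - 2) div int h < Q * int e"
  proof (rule ccontr)
    assume "\<not> ?thesis"
    then have "int h * (Q * int e) \<le> int h * ((int p * int e - 2) div int h)"
      using hpos by (intro mult_left_mono) auto
    also have "\<dots> \<le> int p * int e - 2"
      using minus_mod_eq_mult_div[of "int p * int e - 2" "int h"] pos_mod_sign[OF hpos, of "int p * int e - 2"]
      by linarith
    finally show False using le by (simp add: mult.assoc)
  qed
  then have "((int p * int e - 2) div int h + 1) * int r \<le> (Q * int e) * int r"
    by (intro mult_right_mono) auto
  moreover have "p * (e * r) div (p * e) = r" using p e by (simp flip: mult.assoc)
  moreover have "p * (e * r) div p = e * r" using p by simp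
  ultimately show ?thesis by (simp add: f_def Q_def mult.assoc)
qed

section \<open>Maximal subgroups and lexicographic sets\<close>

context fin_comm_group
begin

lemma maximal_subgroup:
  assumes "subgroup K G" "K \<noteq> carrier G"
  obtains M where "subgroup M G" "K \<subseteq> M" "M \<noteq> carrier G"
    "\<And>L. subgroup L G \<Longrightarrow> M \<subseteq> L \<Longrightarrow> L = M \<or> L = carrier G"
proof -
  let ?F = "{L. subgroup L G \<and> L \<noteq> carrier G}"
  have "?F \<subseteq> Pow (carrier G)" using subgroup.subset by auto
  then have "finite ?F" using fin by (meson finite_Pow_iff finite_subset)
  then obtain M where "M \<in> ?F" "K \<subseteq> M" "\<forall>L\<in>?F. M \<subseteq> L \<longrightarrow> M = L"
    using finite_has_maximal2[of ?F K] assms by auto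
  then show thesis using that[of M] by auto
qed

lemma maximal_subgroup_cyclic_cosets:
  assumes M: "subgroup M G" "M \<noteq> carrier G"
    and max: "\<And>L. subgroup L G \<Longrightarrow> M \<subseteq> L \<Longrightarrow> L = M \<or> L = carrier G"
  obtains x p where "x \<in> carrier G" "p \<ge> 2" "order G = p * card M"
    "\<And>y z i j. y \<in> M \<Longrightarrow> z \<in> M \<Longrightarrow> i < p \<Longrightarrow> j < p \<Longrightarrow> y \<otimes> x [^] i = z \<otimes> x [^] (j::nat) \<Longrightarrow>
      y = z \<and> i = j"
proof -
  have Ms: "M \<subseteq> carrier G" using M by (intro subgroup.subset)
  have M1: "\<one> \<in> M" using M by (intro subgroup.one_closed)
  obtain x where x: "x \<in> carrier G" "x \<notin> M" using M Ms by auto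
  \<comment> \<open>This is the order of \<open>x\<close> modulo \<open>M\<close>. By maximality
    \<open>x\<close> and \<open>M\<close> generate everything, so \<open>p\<close> turns out to be
    the index of \<open>M\<close>.\<close>
  define p where "p = (LEAST i::nat. i > 0 \<and> x [^] i \<in> M)"
  have "order G > 0 \<and> x [^] order G \<in> M"
    using fin x M1 pow_order_eq_1 by (auto simp: order_def card_gt_0_iff)
  then have p: "p > 0" "x [^] p \<in> M"
    unfolding p_def by (rule LeastI2, simp)+
  have pmin: "i = 0 \<or> p \<le> i" if "x [^] i \<in> M" for i :: nat
    using that Least_le[of "\<lambda>i. i > 0 \<and> x [^] i \<in> M" i] by (auto simp: p_def)
  have "p \<noteq> 1" using p x by auto
  then have p2: "p \<ge> 2" using p by simp
  have lt: False
    if "y \<in> M" "z \<in> M" "i < j" "j < p" "y \<otimes> x [^] i = z \<otimes> x [^] j" for y z and i j :: nat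
  proof -
    have c: "y \<in> carrier G" "z \<in> carrier G" using that Ms by auto
    have "x [^] j = x [^] (j - i) \<otimes> x [^] i" using that x by (simp add: nat_pow_mult)
    then have "y \<otimes> x [^] i = (z \<otimes> x [^] (j - i)) \<otimes> x [^] i"
      using that x c by (simp add: m_assoc)
    then have "y = z \<otimes> x [^] (j - i)" using x c by simp
    then have "x [^] (j - i) = inv z \<otimes> y" using x c by (simp add: inv_solve_left)
    then have "x [^] (j - i) \<in> M"
      using that M by (simp add: subgroup.m_closed subgroup.m_inv_closed)
    then show False using pmin[of "j - i"] that by auto
  qed
  have uniq: "y = z \<and> i = j"
    if "y \<in> M" "z \<in> M" "i < p" "j < p" "y \<otimes> x [^] i = z \<otimes> x [^] j" for y z and i j :: nat
  proof -
    have "i = j" using lt that by (metis linorder_neqE_nat)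
    moreover have "y \<in> carrier G" "z \<in> carrier G" "x [^] i \<in> carrier G" using that x Ms by auto
    ultimately show ?thesis using that by (metis r_cancel)
  qed
  let ?U = "M <#> generate G {x}"
  have U: "subgroup ?U G" using mult_subgroups M generate_is_subgroup x by simp
  have xg: "x \<in> generate G {x}" by (simp add: generate.incl)
  have "M \<subseteq> ?U"
  proof
    fix y assume "y \<in> M"
    then show "y \<in> ?U" using set_multI[of y M \<one> _ G] generate.one[of G "{x}"] Ms by fastforce
  qed
  moreover have "x \<in> ?U" using set_multI[OF M1 xg, of G] x by simp
  ultimately have Uc: "?U = carrier G" using max[OF U] x by auto
  have ex: "\<exists>y\<in>M. \<exists>i<p. g = y \<otimes> x [^] i" if "g \<in> carrier G" for g
  proof -
    have "g \<in> ?U" using that Uc by simp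
    then obtain y k where y: "y \<in> M" "g = y \<otimes> x [^] (k::int)"
      using generate_pow[OF x(1)] by (auto elim!: set_multE)
    have yc: "y \<in> carrier G" using y Ms by auto
    \<comment> \<open>Since \<open>x [^] p\<close> lies in \<open>M\<close>, the exponent can be
      reduced modulo \<open>p\<close> and the remaining power absorbed into
      \<open>M\<close>.\<close>
    define i where "i = nat (k mod int p)"
    have i: "int i = k mod int p" "i < p" using p by (auto simp: i_def nat_less_iff)
    have k: "k = int p * (k div int p) + int i" using i by simp
    have "x [^] k = x [^] (int p * (k div int p)) \<otimes> x [^] (int i)"
      by (subst k) (simp add: int_pow_mult x)
    also have "\<dots> = (x [^] p) [^] (k div int p) \<otimes> x [^] i"
      using x by (simp add: int_pow_pow[symmetric] int_pow_int)
    finally have "g = (y \<otimes> (x [^] p) [^] (k div int p)) \<otimes> x [^] i"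
      using y yc x by (simp add: m_assoc)
    moreover have "y \<otimes> (x [^] p) [^] (k div int p) \<in> M"
      using y p M by (simp add: subgroup.m_closed subgroup_int_pow_closed)
    ultimately show ?thesis using i by blast
  qed
  have "bij_betw (\<lambda>(y, i). y \<otimes> x [^] i) (M \<times> {..<p}) (carrier G)"
  proof (rule bij_betw_imageI)
    show "inj_on (\<lambda>(y, i). y \<otimes> x [^] i) (M \<times> {..<p})" using uniq by (auto simp: inj_on_def)
    show "(\<lambda>(y, i). y \<otimes> x [^] i) ` (M \<times> {..<p}) = carrier G"
    proof
      show "(\<lambda>(y, i). y \<otimes> x [^] i) ` (M \<times> {..<p}) \<subseteq> carrier G" using Ms x by auto
      show "carrier G \<subseteq> (\<lambda>(y, i). y \<otimes> x [^] i) ` (M \<times> {..<p})"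
        using ex by (fastforce simp: image_iff)
    qed
  qed
  then have "order G = p * card M"
    using bij_betw_same_card by (fastforce simp: order_def card_cartesian_product mult.commute)
  then show thesis using that[OF x(1) p2] uniq by blast
qed

text \<open>The set consists of the full cosets with exponents below \<open>k\<close> and a copy of
  \<open>A0\<close> at exponent \<open>k\<close>. Its \<open>h\<close>-fold products have exponents
  at most \<open>h * k < p\<close>, so nothing wraps around. The missed element has exponent
  \<open>p - 1\<close> if there is room above \<open>h * k\<close>, and otherwise exponent
  \<open>h * k\<close>.\<close>

lemma lexicographic_set:
  assumes M: "subgroup M G" and x: "x \<in> carrier G"
    and uniq: "\<And>y z i j. y \<in> M \<Longrightarrow> z \<in> M \<Longrightarrow> i < p \<Longrightarrow> j < p \<Longrightarrow>
      y \<otimes> x [^] i = z \<otimes> x [^] (j::nat) \<Longrightarrow> y = z \<and> i = j"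
    and h: "h \<ge> 1" and k: "h * k < p" and A0: "A0 \<subseteq> M"
    and miss: "h * k + 1 < p \<or> kfold G h A0 \<noteq> M"
  obtains A where "A \<subseteq> carrier G" "card A = k * card M + card A0" "kfold G h A \<noteq> carrier G"
proof -
  have Ms: "M \<subseteq> carrier G" using M by (rule subgroup.subset)
  have finM: "finite M" using Ms by (rule fin_sub)
  let ?P = "M \<times> {..<k} \<union> A0 \<times> {k}" and ?g = "\<lambda>(y, i). y \<otimes> x [^] (i::nat)"
  define A where "A = ?g ` ?P"
  have As: "A \<subseteq> carrier G" using Ms A0 x by (auto simp: A_def)
  have "k \<le> h * k" using h by simp
  then have "k < p" using k by linarith
  then have "?P \<subseteq> M \<times> {..<p}" using A0 by auto
  moreover have "inj_on ?g (M \<times> {..<p})" using uniq by (auto simp: inj_on_def)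
  ultimately have "inj_on ?g ?P" by (rule inj_on_subset[rotated])
  then have "card A = card ?P" unfolding A_def by (rule card_image)
  also have "\<dots> = card (M \<times> {..<k}) + card (A0 \<times> {k})"
    using finM A0 by (intro card_Un_disjoint) (auto intro: finite_subset)
  finally have cA: "card A = k * card M + card A0" by (simp add: card_cartesian_product)
  \<comment> \<open>The top exponent \<open>j * k\<close> is reached only when every factor has
    exponent \<open>k\<close>, hence comes from the copy of \<open>A0\<close>.\<close>
  have mem: "\<exists>y\<in>M. \<exists>i\<le>j * k. s = y \<otimes> x [^] i \<and> (i = j * k \<longrightarrow> y \<in> kfold G j A0)"
    if "s \<in> kfold G j A" for s j
    using that
  proof (induction j arbitrary: s)
    case 0
    then show ?case using subgroup.one_closed[OF M] by auto
  next
    case (Suc j)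
    obtain a t where s: "a \<in> A" "t \<in> kfold G j A" "s = a \<otimes> t"
      using Suc.prems by (auto elim: set_multE)
    obtain y i where y: "y \<in> M" "i \<le> k" "i = k \<longrightarrow> y \<in> A0" "a = y \<otimes> x [^] i"
    proof -
      from s(1) obtain y i where "(y, i) \<in> ?P" "a = y \<otimes> x [^] i" by (auto simp: A_def)
      then show thesis using that[of y i] A0 by auto
    qed
    obtain z l where z: "z \<in> M" "l \<le> j * k" "t = z \<otimes> x [^] l" "l = j * k \<longrightarrow> z \<in> kfold G j A0"
      using Suc.IH[OF s(2)] by auto
    have c: "y \<in> carrier G" "z \<in> carrier G" using y z Ms by auto
    have "s = (y \<otimes> z) \<otimes> (x [^] i \<otimes> x [^] l)" using s y z c x by (simp add: m_ac)
    also have "x [^] i \<otimes> x [^] l = x [^] (i + l)" using x by (simp add: nat_pow_mult)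
    finally have "s = (y \<otimes> z) \<otimes> x [^] (i + l)" .
    moreover have "y \<otimes> z \<in> M" using y z M by (simp add: subgroup.m_closed)
    moreover have "i + l \<le> Suc j * k" using y z by simp
    moreover have "y \<otimes> z \<in> kfold G (Suc j) A0" if "i + l = Suc j * k"
    proof -
      have "i = k" "l = j * k" using that y z by auto
      then show ?thesis using y z by (auto intro: set_multI)
    qed
    ultimately show ?case by blast
  qed
  have kA0: "kfold G h A0 \<subseteq> M"
  proof -
    interpret M: fin_comm_group "G\<lparr>carrier := M\<rparr>" using M by (rule fin_comm_group_subgroup)
    show ?thesis using M.kfold_closed[of A0 h] A0 by simp
  qed
  have "kfold G h A \<noteq> carrier G"
  proof
    assume eq: "kfold G h A = carrier G"
    from miss show False
    proof
      assume lt: "h * k + 1 < p"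
      have "x [^] (p - 1) \<in> kfold G h A" using eq x by simp
      then obtain y i where y: "y \<in> M" "i \<le> h * k" "x [^] (p - 1) = y \<otimes> x [^] i"
        using mem by blast
      then have "\<one> \<otimes> x [^] (p - 1) = y \<otimes> x [^] i" by (metis l_one nat_pow_closed x)
      then have "p - 1 = i" using uniq[of \<one> y "p - 1" i] y lt subgroup.one_closed[OF M] by simp
      then show False using lt y by simp
    next
      assume "kfold G h A0 \<noteq> M"
      then obtain z where z: "z \<in> M" "z \<notin> kfold G h A0" using kA0 by auto
      then have "z \<otimes> x [^] (h * k) \<in> kfold G h A" using eq x Ms by auto
      then obtain y i where y: "y \<in> M" "i \<le> h * k" "z \<otimes> x [^] (h * k) = y \<otimes> x [^] i"
          "i = h * k \<longrightarrow> y \<in> kfold G h A0"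
        using mem by blast
      then have "z = y \<and> h * k = i" using uniq[of z y "h * k" i] z k by simp
      then show False using y z by simp
    qed
  qed
  then show thesis using that As cA by blast
qed

text \<open>The subgroup \<open>K\<close> encodes the divisor as its index. It stays fixed while the
  group descends through maximal subgroups containing it.\<close>

lemma ex_card_ge_f_step:
  assumes h: "h \<ge> 1" and K: "subgroup K G"
    and IH: "\<And>M. subgroup M G \<Longrightarrow> M \<noteq> carrier G \<Longrightarrow> K \<subseteq> M \<Longrightarrow>
      \<exists>A\<subseteq>M. f (card M div card K) (card M) h \<le> int (card A) \<and> kfold G h A \<noteq> M"
  shows "\<exists>A\<subseteq>carrier G. f (order G div card K) (order G) h \<le> int (card A) \<and>
    kfold G h A \<noteq> carrier G"
proof (cases "K = carrier G")
  case True
  have "order G > 0" using fin by (auto simp: order_def card_gt_0_iff)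
  \<comment> \<open>The divisor is 1 here and the floor of \<open>-1 / h\<close> is
    \<open>-1\<close>, so the empty set suffices.\<close>
  then have "f (order G div card K) (order G) h = 0" using True f_one[OF h] by (simp add: order_def)
  moreover have "kfold G h {} = {}" using h by (cases h) (auto simp: set_mult_def)
  ultimately show ?thesis by (intro exI[of _ "{}"]) auto
next
  case False
  obtain M where M: "subgroup M G" "K \<subseteq> M" "M \<noteq> carrier G"
    and max: "\<And>L. subgroup L G \<Longrightarrow> M \<subseteq> L \<Longrightarrow> L = M \<or> L = carrier G"
    using maximal_subgroup[OF K False] by blast
  obtain x p where x: "x \<in> carrier G" and p: "p \<ge> 2" "order G = p * card M"
    and uniq: "\<And>y z i j. y \<in> M \<Longrightarrow> z \<in> M \<Longrightarrow> i < p \<Longrightarrow> j < p \<Longrightarrow>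
      y \<otimes> x [^] i = z \<otimes> x [^] (j::nat) \<Longrightarrow> y = z \<and> i = j"
    using maximal_subgroup_cyclic_cosets[OF M(1,3) max] by blast
  interpret M: fin_comm_group "G\<lparr>carrier := M\<rparr>" using M(1) by (rule fin_comm_group_subgroup)
  define r where "r = card K"
  obtain e where e: "card M = e * r"
    using M.lagrange[OF subgroup_incl[OF K M(1,2)]] unfolding order_def r_def by simp metis
  have "card M > 0" using M.fin M.one_closed by (auto simp: card_gt_0_iff)
  then have er: "e > 0" "r > 0" using e by auto
  have d: "order G div card K = p * e" using p er by (simp add: e flip: r_def)
  show ?thesis
  proof (cases "h dvd p - 1")
    case True
    \<comment> \<open>Now \<open>h * k = p - 1\<close> is the last exponent, where the set obtained
      for \<open>M\<close> prevents covering; \<open>f_mult\<close> shows that the count is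
      exact.\<close>
    define k where "k = (p - 1) div h"
    have pk: "p = 1 + h * k" using True p by (simp add: k_def)
    then have hk: "h * k < p" by simp
    obtain A0 where A0: "A0 \<subseteq> M" "f e (card M) h \<le> int (card A0)" "kfold G h A0 \<noteq> M"
    proof -
      have "card M div card K = e" using e er by (simp flip: r_def)
      then show thesis using IH[OF M(1,3,2)] that by auto
    qed
    obtain A where A: "A \<subseteq> carrier G" "card A = k * card M + card A0" "kfold G h A \<noteq> carrier G"
      by (rule lexicographic_set[OF M(1) x _ h hk A0(1) disjI2[OF A0(3)]]) (use uniq in blast)+
    have "f (order G div card K) (order G) h = int (k * card M) + f e (card M) h"
      unfolding d unfolding p(2) pk using f_mult[OF h, of e "card M" k] e \<open>card M > 0\<close>
      by (simp only: dvd_triv_left)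
    then show ?thesis using A A0(2) by (intro exI[of _ A]) auto
  next
    case False
    \<comment> \<open>Here a set made of \<open>k + 1\<close> full cosets attains the value for the
      divisor \<open>p\<close>, which by \<open>f_mult_le\<close> dominates the one for
      \<open>p * e\<close>.\<close>
    define k where "k = (p - 2) div h"
    have "h * k \<le> p - 2" by (simp add: k_def)
    then have hk: "h * k < p" "h * k + 1 < p" using p by simp_all
    obtain A where A: "A \<subseteq> carrier G" "card A = k * card M + card M" "kfold G h A \<noteq> carrier G"
      by (rule lexicographic_set[OF M(1) x _ h hk(1) order_refl disjI1[OF hk(2)]])
        (use uniq in blast)+
    have "f (order G div card K) (order G) h \<le> f p (order G) h"
      unfolding d unfolding p(2) e using p False er by (intro f_mult_le[OF h]) auto
    also have "\<dots> = int (card A)"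
    proof -
      have "(int p - 2) div int h = int k" using p by (simp add: k_def zdiv_int of_nat_diff)
      then show ?thesis using p A by (simp add: f_def algebra_simps)
    qed
    finally show ?thesis using A by (intro exI[of _ A]) auto
  qed
qed

text \<open>Converse of Lagrange's theorem for abelian groups: a subgroup of order
  \<open>p ^ a\<close> from Sylow's theorem is multiplied by one of the coprime order
  \<open>e'\<close>. Both orders divide that of the product, which is at most
  \<open>p ^ a * e'\<close>.\<close>

lemma ex_subgroup_card:
  "e dvd order G \<Longrightarrow> \<exists>K. subgroup K G \<and> card K = e"
proof (induction e rule: less_induct)
  case (less e)
  have "order G > 0" using fin by (auto simp: order_def card_gt_0_iff)
  then have e0: "e > 0" using less.prems by (auto intro: Nat.gr0I)
  show ?case
  proof (cases "e = 1")
    case True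
    then show ?thesis using triv_subgroup by (intro exI[of _ "{\<one>}"]) simp
  next
    case False
    then obtain p where p: "Factorial_Ring.prime p" "p dvd e" using prime_factor_nat by blast
    obtain e' where e': "e = p ^ multiplicity p e * e'" "\<not> p dvd e'"
      using multiplicity_decompose'[of e p] prime_gt_1_nat[OF p(1)] e0 by auto
    define a where "a = multiplicity p e"
    have "a > 0" using p e0 by (simp add: a_def prime_multiplicity_gt_zero_iff)
    then have pa: "p ^ a > 1" using prime_gt_1_nat[OF p(1)] by (simp add: one_less_power del: One_nat_def)
    have ee: "e = p ^ a * e'" using e' by (simp add: a_def)
    have "e' > 0" using ee e0 by (auto intro: Nat.gr0I)
    then have "e' < e" unfolding ee using pa mult_strict_right_mono[of 1 "p ^ a" e'] by simp
    moreover have "e' dvd order G" using less.prems ee by (metis dvd_mult_right)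
    ultimately obtain K where K: "subgroup K G" "card K = e'" using less.IH by blast
    obtain m where "order G = p ^ a * m" using less.prems ee by (metis dvd_def dvd_mult_left)
    then obtain H where H: "subgroup H G" "card H = p ^ a"
      using sylow_thm[OF p(1) is_group _ fin] by blast
    have s: "H \<subseteq> carrier G" "K \<subseteq> carrier G" using H K subgroup.subset by auto
    have sub: "subgroup (H <#> K) G" using H K by (simp add: mult_subgroups)
    have "p ^ a dvd card (H <#> K)" using card_dvd_set_mult[OF H(1) s(2)] H by simp
    moreover have "e' dvd card (H <#> K)"
      using card_dvd_set_mult[OF K(1) s(1)] K set_mult_comm[OF s] by simp
    moreover have "coprime (p ^ a) e'" using e'(2) p by (simp add: prime_imp_coprime)
    ultimately have dvd: "e dvd card (H <#> K)" unfolding ee by (intro divides_mult)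
    have "H <#> K = (\<lambda>(x, y). x \<otimes> y) ` (H \<times> K)" by (auto simp: set_mult_def)
    then have "card (H <#> K) \<le> card (H \<times> K)"
      using s fin_sub by (metis card_image_le finite_cartesian_product)
    then have "card (H <#> K) \<le> e" using H K ee by (simp add: card_cartesian_product)
    moreover have "card (H <#> K) > 0"
      using subgroup.one_closed[OF sub] fin_sub[OF subgroup.subset[OF sub]] by (auto simp: card_gt_0_iff)
    ultimately have "card (H <#> K) = e" using dvd by (meson dvd_imp_le le_antisym)
    then show ?thesis using sub by blast
  qed
qed

text \<open>A set that does not generate lies in a maximal subgroup \<open>M\<close> and can be
  replaced by a coset of \<open>M\<close> other than \<open>M\<close>. Its powers stay within single
  cosets, but the subgroup it generates contains both \<open>x\<close> and \<open>M\<close>.\<close>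

lemma generating_set_card_ge:
  assumes A: "A \<subseteq> carrier G" "kfold G h A \<noteq> carrier G"
  obtains B where "B \<subseteq> carrier G" "generate G B = carrier G" "card A \<le> card B"
    "kfold G h B \<noteq> carrier G"
proof (cases "generate G A = carrier G")
  case True
  then show ?thesis using that A by blast
next
  case False
  obtain M where M: "subgroup M G" "generate G A \<subseteq> M" "M \<noteq> carrier G"
    and max: "\<And>L. subgroup L G \<Longrightarrow> M \<subseteq> L \<Longrightarrow> L = M \<or> L = carrier G"
    using maximal_subgroup[OF generate_is_subgroup[OF A(1)] False] by blast
  have Ms: "M \<subseteq> carrier G" using M by (intro subgroup.subset)
  obtain x where x: "x \<in> carrier G" "x \<notin> M" using M Ms by auto
  let ?B = "{x} <#> M"
  have B: "?B \<subseteq> carrier G" using x Ms by (simp add: set_mult_closed)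
  have cB: "card ?B = card M" using x Ms by (simp add: card_translate)
  interpret M: fin_comm_group "G\<lparr>carrier := M\<rparr>" using M(1) by (rule fin_comm_group_subgroup)
  show ?thesis
  proof (rule that[OF B])
    have "A \<subseteq> M" using M(2) by (auto intro: generate.incl)
    then show "card A \<le> card ?B" unfolding cB using Ms fin_sub by (simp add: card_mono)
    have "kfold G h M \<subseteq> M" using M.kfold_closed[of M h] by simp
    then have "card (kfold G h ?B) \<le> card M"
      using x Ms kfold_closed[OF Ms] fin_sub[OF Ms]
      by (simp add: kfold_translate card_translate card_mono)
    moreover have "card M < card (carrier G)" using M(3) Ms by (intro psubset_card_mono[OF fin]) auto
    ultimately show "kfold G h ?B \<noteq> carrier G" by auto
    let ?L = "generate G ?B"
    have L: "subgroup ?L G" using generate_is_subgroup[OF B] .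
    have xL: "x \<in> ?L"
      using set_multI[of x "{x}" \<one> M G] subgroup.one_closed[OF M(1)] x by (auto intro: generate.incl)
    have "M \<subseteq> ?L"
    proof
      fix y assume y: "y \<in> M"
      then have "x \<otimes> y \<in> ?L" by (auto intro!: generate.incl set_multI)
      then have "inv x \<otimes> (x \<otimes> y) \<in> ?L"
        using xL L by (simp add: subgroup.m_closed subgroup.m_inv_closed)
      moreover have "inv x \<otimes> (x \<otimes> y) = y" using x y Ms by (auto simp flip: m_assoc)
      ultimately show "y \<in> ?L" by simp
    qed
    then show "?L = carrier G" using max[OF L] xL x by auto
  qed
qed

end

proposition ex_card_ge_f:
  fixes G :: "('a, 'b) monoid_scheme"
  assumes "fin_comm_group G" "h \<ge> 1" "subgroup K G"
  shows "\<exists>A\<subseteq>carrier G. f (order G div card K) (order G) h \<le> int (card A) \<and>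
    kfold G h A \<noteq> carrier G"
  using assms
proof (induction "order G" arbitrary: G rule: less_induct)
  case less
  interpret fin_comm_group G by fact
  show ?case
  proof (rule ex_card_ge_f_step[OF less.prems(2,3)])
    fix M
    assume M: "subgroup M G" "M \<noteq> carrier G" "K \<subseteq> M"
    have "order (G\<lparr>carrier := M\<rparr>) < order G"
      using M subgroup.subset[OF M(1)] by (auto simp: order_def intro!: psubset_card_mono fin)
    then show "\<exists>A\<subseteq>M. f (card M div card K) (card M) h \<le> int (card A) \<and> kfold G h A \<noteq> M"
      using less.hyps[of "G\<lparr>carrier := M\<rparr>"] fin_comm_group_subgroup[OF M(1)] less.prems(2)
        subgroup_incl[OF less.prems(3) M(1,3)]
      by (simp add: order_def)
  qed
qed

section \<open>Evaluation of both minima\<close>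

theorem theorem4:
  fixes G :: "('a, 'b) monoid_scheme" and n h :: nat
  assumes "comm_group G" and "finite (carrier G)" and "order G = n" and "n \<ge> 2" and "h \<ge> 1"
  shows "chi_hat G h = chi G h \<and> int (chi G h) = v n h + 1"
proof -
  note h = \<open>h \<ge> 1\<close> and n = \<open>n \<ge> 2\<close> and order = \<open>order G = n\<close>
  have FG: "fin_comm_group G"
    using assms(1,2) by (simp add: fin_comm_group_def fin_comm_group_axioms_def)
  interpret fin_comm_group G by (rule FG)
  let ?F = "{f d n h | d. 0 < d \<and> d dvd n}"
  have "0 < d" if "d dvd n" for d using that n by (auto intro: Nat.gr0I)
  then have "?F = (\<lambda>d. f d n h) ` {d. d dvd n}" by blast
  then have F: "finite ?F" using n by simp
  have fn: "f n n h \<in> ?F" using n by auto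
  \<comment> \<open>Positivity of \<open>v n h\<close> makes its conversion to a natural number
    faithful.\<close>
  have "f n n h \<ge> 1" using n h by (simp add: f_def pos_imp_zdiv_nonneg_iff)
  moreover have "f n n h \<le> v n h" unfolding v_def using F fn by (rule Max_ge)
  ultimately have v1: "v n h \<ge> 1" by linarith
  have "v n h \<in> ?F" unfolding v_def using F fn by (intro Max_in) auto
  then obtain d where d: "v n h = f d n h" "0 < d" "d dvd n" by auto
  define m where "m = nat (v n h)"
  have m: "int m = v n h" using v1 by (simp add: m_def)
  have upper: "sumset G h A = carrier G" if A: "A \<subseteq> carrier G" "m + 1 \<le> card A" for A
  proof (rule ccontr)
    assume "sumset G h A \<noteq> carrier G"
    then obtain e where "e > 0" "e dvd n" "int (card A) \<le> f e n h"
      using ex_f_ge_card[OF FG h A(1)] sumset_eq_kfold[OF A(1)] order by auto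
    moreover from this have "f e n h \<le> v n h" unfolding v_def using F by (intro Max_ge) auto
    ultimately show False using A(2) m by linarith
  qed
  \<comment> \<open>One generating set of size at least \<open>m\<close> serves as the
    counterexample for both minima.\<close>
  obtain B where B: "B \<subseteq> carrier G" "generate G B = carrier G" "m \<le> card B"
    "sumset G h B \<noteq> carrier G"
  proof -
    have "n div d dvd order G" using d(3) order by (metis dvd_div_mult_self dvd_triv_left)
    then obtain K where K: "subgroup K G" "card K = n div d" using ex_subgroup_card by blast
    obtain r where r: "n = d * r" using d(3) by (auto elim: dvdE)
    then have "r > 0" using n by (auto intro: Nat.gr0I)
    then have "order G div card K = d" unfolding K(2) order using d(2) by (simp add: r)
    then obtain A where A: "A \<subseteq> carrier G" "v n h \<le> int (card A)" "kfold G h A \<noteq> carrier G"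
      using ex_card_ge_f[OF FG h K(1)] d order by auto
    obtain B where "B \<subseteq> carrier G" "generate G B = carrier G" "card A \<le> card B"
        "kfold G h B \<noteq> carrier G"
      using generating_set_card_ge[OF A(1,3)] by blast
    then show thesis using that[of B] A(2) m by (simp add: sumset_eq_kfold)
  qed
  have "chi G h = m + 1"
    unfolding chi_def
  proof (rule Least_equality)
    show "\<forall>A. A \<subseteq> carrier G \<and> m + 1 \<le> card A \<longrightarrow> sumset G h A = carrier G" using upper by blast
    fix l assume "\<forall>A. A \<subseteq> carrier G \<and> l \<le> card A \<longrightarrow> sumset G h A = carrier G"
    then have "\<not> l \<le> card B" using B by blast
    then show "m + 1 \<le> l" using B(3) by linarith
  qed
  moreover have "chi_hat G h = m + 1"
    unfolding chi_hat_def
  proof (rule Least_equality)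
    show "\<forall>A. A \<subseteq> carrier G \<and> generate G A = carrier G \<and> m + 1 \<le> card A \<longrightarrow>
      sumset G h A = carrier G" using upper by blast
    fix l assume "\<forall>A. A \<subseteq> carrier G \<and> generate G A = carrier G \<and> l \<le> card A \<longrightarrow>
      sumset G h A = carrier G"
    then have "\<not> l \<le> card B" using B by blast
    then show "m + 1 \<le> l" using B(3) by linarith
  qed
  ultimately show ?thesis using m by simp
qed

end
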